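(* For every $n\ge 1$, $\lambda\in\mathbb{R}_+$, $c\in\mathbb{R}$ such that $\psi^{(a)}$ has no points of increase in the interval $(c,c+1)$, and $a>0$, the Sobolev-type Charlier polynomials $\{Q_n^\lambda\}_{n\ge0}$ satisfy the second order difference equation $$\sigma(x)\,\Delta\nabla Q_{n}^{\lambda}(x)+\tau(x)\,\Delta Q_{n}^{\lambda}(x)+\mu(x)\,Q_{n}^{\lambda}(x)=0,$$ where $$\sigma(x)=\mathcal{F}_2(x;n),\qquad \tau(x)=\Delta\mathcal{F}_2(x;n)+\mathcal{G}_2(x+1;n)+\mathcal{R}(x;n),\qquad \mu(x)=\Delta\mathcal{G}_2(x;n)+\mathcal{S}(x;n).$$ When $\lambda=0$ this equation becomes the hypergeometric type difference equation of the Charlier polynomials, $$x\,\Delta\nabla C_n^{(a)}(x)+(a-x)\,\Delta C_n^{(a)}(x)+n\,C_n^{(a)}(x)=0.$$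
   Context: Let $a>0$ and let $\psi^{(a)}$ be the Poisson distribution, the discrete measure with mass $e^{-a}a^{x}/x!$ at $x=0,1,2,\ldots$. "No points of increase in $(c,c+1)$" means that $(c,c+1)$ contains no nonnegative integer. $\Delta f(x)=f(x+1)-f(x)$ and $\nabla f(x)=f(x)-f(x-1)$, acting on the variable $x$. $\{C_n^{(a)}\}_{n\ge0}$ are the monic Charlier polynomials, orthogonal with respect to $\langle p,q\rangle=\int_0^\infty pq\,d\psi^{(a)}$; $C_{-1}^{(a)}=0$, $C_0^{(a)}=1$, $C_{n+1}^{(a)}(x)=(x-n-a)C_n^{(a)}(x)-na\,C_{n-1}^{(a)}(x)$, $\|C_n^{(a)}\|^2=n!a^n$. $\{Q_n^\lambda\}_{n\ge0}$ is the sequence of monic polynomials ($\deg Q_n^\lambda=n$) orthogonal with respect to $\langle p,q\rangle_\lambda=\int_0^\infty pq\,d\psi^{(a)}+\lambda\,\Delta p(c)\,\Delta q(c)$. For $\lambda=0$ one has $Q_n^0=C_n^{(a)}$, and all functions below are taken with $\lambda=0$ (so $A_1\equiv1$, $B_1\equiv0$); the equation obtained is then the displayed Charlier equation divided by the constant $a$. Put $$A_{1}(x;n)=1-\lambda \frac{\Delta Q_{n}^{\lambda }(c)}{\|C_{n-1}^{(a)}\|^{2}}\,\frac{C_{n-1}^{(a)}(c)+(x-c)\Delta C_{n-1}^{(a)}(c)}{(x-c)(x-c-1)},\qquad B_{1}(x;n)=\lambda \frac{\Delta Q_{n}^{\lambda }(c)}{\|C_{n-1}^{(a)}\|^{2}}\,\frac{C_{n}^{(a)}(c)+(x-c)\Delta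 C_{n}^{(a)}(c)}{(x-c)(x-c-1)},$$ $$C_1(x;n)=A_1(x+1;n)-A_1(x;n)-\tfrac1a B_1(x+1;n),$$ $$D_1(x;n)=nA_1(x+1;n)-B_1(x;n)+\tfrac{x-n+1}{a}B_1(x+1;n),$$ $$C_3(x;n)=\nabla A_1(x;n)+nx^{-1}A_1(x-1;n)-x^{-1}B_1(x-1;n),$$ $$D_3(x;n)=\nabla B_1(x;n)+nax^{-1}A_1(x-1;n)+(x-a)x^{-1}B_1(x-1;n),$$ $$A_2(x;n)=\frac{-B_1(x;n-1)}{a(n-1)},\qquad B_2(x;n)=A_1(x;n-1)+\frac{x-n-a+1}{a(n-1)}B_1(x;n-1),$$ $$C_2(x;n)=\frac{aB_1(x;n-1)-a(n-1)A_1(x+1;n-1)-(x-n+2)B_1(x+1;n-1)}{a^2(n-1)},$$ $$D_2(x;n)=\frac{a(n-1)(1-n+x)A_1(x+1;n-1)+a(-1+a+n-x)B_1(x;n-1)}{a^2(n-1)}-A_1(x;n-1)+\frac{[(n-x-2)(n-x-1)-a(1+x)]B_1(x+1;n-1)}{a^2(n-1)},$$ $$\Lambda(x;n)=A_1(x;n)B_2(x;n)-B_1(x;n)A_2(x;n),$$ and for $k=1,2$ $$\Xi_k(x;n)=\frac{C_1(x;n)B_k(x;n)-A_k(x;n)D_1(x;n)}{\Lambda(x;n)},\qquad \Theta_k(x;n)=\frac{C_2(x;n)B_k(x;n)-A_k(x;n)D_2(x;n)}{\Lambda(x;n)},$$ $$\Phi_k(x;n)=C_3(x;n)B_k(x;n)-A_k(x;n)D_3(x;n).$$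 Further, $$\mathcal{F}_1(x;n)=-\frac{\Lambda(x;n)}{\Phi_1(x;n)},\qquad \mathcal{G}_1(x;n)=\frac{\Phi_2(x;n)}{\Phi_1(x;n)},$$ $$\mathcal{F}_2(x;n)=-\Xi_1(x;n)\mathcal{F}_1(x;n),\qquad \mathcal{G}_2(x;n)=\Xi_2(x;n)-\Xi_1(x;n)\mathcal{G}_1(x;n),$$ $$\mathcal{R}(x;n)=\frac{[\Theta_1(x;n)-1]\Delta\Xi_1(x;n)}{\Xi_1(x;n)}-\Delta\Xi_2(x;n)+\Theta_1(x;n)-\Xi_2(x;n),$$ $$\mathcal{S}(x;n)=\Theta_2(x;n)[\Xi_1(x;n)+\Delta\Xi_1(x;n)]-\Delta\Xi_2(x;n)-\Theta_1(x;n)\Xi_2(x;n)-\frac{\Xi_2(x;n)[\Theta_1(x;n)-1]\Delta\Xi_1(x;n)}{\Xi_1(x;n)}.$$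
   Formalization: For n=1 the printed A_2, B_2, C_2, D_2 divide by n-1=0; here the factor n-1 is cancelled in the A_1 terms of C_2 and D_2, and B_1(x;0)=0, A_1(x;0)=1 with the terms B_1(x;0)/(n-1) read as 0. For n≥2 all formulas are as printed. *)

theory Defs
  imports "HOL-Probability.Probability" "HOL-Computational_Algebra.Polynomial"
begin

definition fwd_diff :: "(real \<Rightarrow> real) \<Rightarrow> real \<Rightarrow> real" where
  "fwd_diff f x = f (x + 1) - f x"

definition bwd_diff :: "(real \<Rightarrow> real) \<Rightarrow> real \<Rightarrow> real" where
  "bwd_diff f x = f x - f (x - 1)"

definition charlier_ip :: "real \<Rightarrow> real poly \<Rightarrow> real poly \<Rightarrow> real" where
  "charlier_ip a p q =
     measure_pmf.expectation (poisson_pmf a) (\<lambda>k. poly p (real k) * poly q (real k))"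

definition sobolev_ip :: "real \<Rightarrow> real \<Rightarrow> real \<Rightarrow> real poly \<Rightarrow> real poly \<Rightarrow> real" where
  "sobolev_ip a c lam p q =
     charlier_ip a p q + lam * fwd_diff (poly p) c * fwd_diff (poly q) c"

fun charlier :: "real \<Rightarrow> nat \<Rightarrow> real poly" where
  "charlier a 0 = 1"
| "charlier a (Suc 0) = [:- a, 1:]"
| "charlier a (Suc (Suc n)) =
     [:- real (Suc n) - a, 1:] * charlier a (Suc n) - smult (real (Suc n) * a) (charlier a n)"

definition monic_orthogonal_seq ::
    "(real poly \<Rightarrow> real poly \<Rightarrow> real) \<Rightarrow> (nat \<Rightarrow> real poly) \<Rightarrow> bool" where
  "monic_orthogonal_seq ip P \<longleftrightarrow>
     (\<forall>n. degree (P n) = n \<and> lead_coeff (P n) = 1) \<and>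
     (\<forall>m n. m \<noteq> n \<longrightarrow> ip (P m) (P n) = 0)"

text \<open>
  The coefficient functions below are rational in \<open>x\<close>; \<open>Q\<close> is the Sobolev-type Charlier sequence.
\<close>

context
  fixes a c lam :: real and Q :: "nat \<Rightarrow> real poly"
begin

text \<open>
  For \<open>n = 0\<close> the factor \<open>fwd_diff (poly (Q 0)) c\<close> vanishes (\<open>Q 0\<close> is constant), so the truncated
  index \<open>n - 1\<close> plays no role there: \<open>A1 x 0 = 1\<close> and \<open>B1 x 0 = 0\<close>.
\<close>

definition A1 :: "real \<Rightarrow> nat \<Rightarrow> real" where
  "A1 x n = 1 - lam * (fwd_diff (poly (Q n)) c
                        / charlier_ip a (charlier a (n - 1)) (charlier a (n - 1)))
     * ((poly (charlier a (n - 1)) c + (x - c) * fwd_diff (poly (charlier a (n - 1))) c)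
        / ((x - c) * (x - c - 1)))"

definition B1 :: "real \<Rightarrow> nat \<Rightarrow> real" where
  "B1 x n = lam * (fwd_diff (poly (Q n)) c
                    / charlier_ip a (charlier a (n - 1)) (charlier a (n - 1)))
     * ((poly (charlier a n) c + (x - c) * fwd_diff (poly (charlier a n)) c)
        / ((x - c) * (x - c - 1)))"

definition C1 :: "real \<Rightarrow> nat \<Rightarrow> real" where
  "C1 x n = A1 (x + 1) n - A1 x n - 1 / a * B1 (x + 1) n"

definition D1 :: "real \<Rightarrow> nat \<Rightarrow> real" where
  "D1 x n = real n * A1 (x + 1) n - B1 x n + (x - real n + 1) / a * B1 (x + 1) n"

definition C3 :: "real \<Rightarrow> nat \<Rightarrow> real" where
  "C3 x n = bwd_diff (\<lambda>t. A1 t n) x + real n / x * A1 (x - 1) n - 1 / x * B1 (x - 1) n"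

definition D3 :: "real \<Rightarrow> nat \<Rightarrow> real" where
  "D3 x n = bwd_diff (\<lambda>t. B1 t n) x + real n * a / x * A1 (x - 1) n
     + (x - a) / x * B1 (x - 1) n"

text \<open>
  In \<open>C2\<close> and \<open>D2\<close> the factor \<open>n - 1\<close> common to numerator and denominator of the \<open>A1\<close> terms is
  cancelled. This changes nothing for \<open>n \<ge> 2\<close>. For \<open>n = 1\<close> the remaining divisions by \<open>n - 1\<close> all
  have numerator \<open>B1 _ 0 = 0\<close> and so evaluate to \<open>0\<close>. With these values the identities defining the
  functions, \<open>Q (n - 1) = A2 * charlier a n + B2 * charlier a (n - 1)\<close> and
  \<open>fwd_diff (Q (n - 1)) = C2 * charlier a n + D2 * charlier a (n - 1)\<close>, hold for \<open>n = 1\<close> as well.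
\<close>

definition A2 :: "real \<Rightarrow> nat \<Rightarrow> real" where
  "A2 x n = - B1 x (n - 1) / (a * (real n - 1))"

definition B2 :: "real \<Rightarrow> nat \<Rightarrow> real" where
  "B2 x n = A1 x (n - 1) + (x - real n - a + 1) / (a * (real n - 1)) * B1 x (n - 1)"

definition C2 :: "real \<Rightarrow> nat \<Rightarrow> real" where
  "C2 x n = (a * B1 x (n - 1) - (x - real n + 2) * B1 (x + 1) (n - 1)) / (a\<^sup>2 * (real n - 1))
     - A1 (x + 1) (n - 1) / a"

definition D2 :: "real \<Rightarrow> nat \<Rightarrow> real" where
  "D2 x n = (1 - real n + x) * A1 (x + 1) (n - 1) / a
     + a * (- 1 + a + real n - x) * B1 x (n - 1) / (a\<^sup>2 * (real n - 1))
     - A1 x (n - 1)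
     + ((real n - x - 2) * (real n - x - 1) - a * (1 + x)) * B1 (x + 1) (n - 1)
         / (a\<^sup>2 * (real n - 1))"

definition Lam :: "real \<Rightarrow> nat \<Rightarrow> real" where
  "Lam x n = A1 x n * B2 x n - B1 x n * A2 x n"

definition Xi1 :: "real \<Rightarrow> nat \<Rightarrow> real" where
  "Xi1 x n = (C1 x n * B1 x n - A1 x n * D1 x n) / Lam x n"

definition Xi2 :: "real \<Rightarrow> nat \<Rightarrow> real" where
  "Xi2 x n = (C1 x n * B2 x n - A2 x n * D1 x n) / Lam x n"

definition Theta1 :: "real \<Rightarrow> nat \<Rightarrow> real" where
  "Theta1 x n = (C2 x n * B1 x n - A1 x n * D2 x n) / Lam x n"

definition Theta2 :: "real \<Rightarrow> nat \<Rightarrow> real" where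
  "Theta2 x n = (C2 x n * B2 x n - A2 x n * D2 x n) / Lam x n"

definition Phi1 :: "real \<Rightarrow> nat \<Rightarrow> real" where
  "Phi1 x n = C3 x n * B1 x n - A1 x n * D3 x n"

definition Phi2 :: "real \<Rightarrow> nat \<Rightarrow> real" where
  "Phi2 x n = C3 x n * B2 x n - A2 x n * D3 x n"

definition F1 :: "real \<Rightarrow> nat \<Rightarrow> real" where
  "F1 x n = - (Lam x n / Phi1 x n)"

definition G1 :: "real \<Rightarrow> nat \<Rightarrow> real" where
  "G1 x n = Phi2 x n / Phi1 x n"

definition F2 :: "real \<Rightarrow> nat \<Rightarrow> real" where
  "F2 x n = - Xi1 x n * F1 x n"

definition G2 :: "real \<Rightarrow> nat \<Rightarrow> real" where
  "G2 x n = Xi2 x n - Xi1 x n * G1 x n"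

definition R :: "real \<Rightarrow> nat \<Rightarrow> real" where
  "R x n = (Theta1 x n - 1) * fwd_diff (\<lambda>t. Xi1 t n) x / Xi1 x n
     - fwd_diff (\<lambda>t. Xi2 t n) x + Theta1 x n - Xi2 x n"

definition S :: "real \<Rightarrow> nat \<Rightarrow> real" where
  "S x n = Theta2 x n * (Xi1 x n + fwd_diff (\<lambda>t. Xi1 t n) x)
     - fwd_diff (\<lambda>t. Xi2 t n) x - Theta1 x n * Xi2 x n
     - Xi2 x n * (Theta1 x n - 1) * fwd_diff (\<lambda>t. Xi1 t n) x / Xi1 x n"

definition sigma_coeff :: "real \<Rightarrow> nat \<Rightarrow> real" where
  "sigma_coeff x n = F2 x n"

definition tau_coeff :: "real \<Rightarrow> nat \<Rightarrow> real" where
  "tau_coeff x n = fwd_diff (\<lambda>t. F2 t n) x + G2 (x + 1) n + R x n"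

definition mu_coeff :: "real \<Rightarrow> nat \<Rightarrow> real" where
  "mu_coeff x n = fwd_diff (\<lambda>t. G2 t n) x + S x n"

text \<open>
  No division by zero occurs in the formulas for \<open>sigma_coeff x n\<close>, \<open>tau_coeff x n\<close>, \<open>mu_coeff x n\<close>. They evaluate
  \<open>A1\<close> and \<open>B1\<close> (poles at \<open>c\<close> and \<open>c + 1\<close>, unless \<open>lam = 0\<close>) at \<open>x - 1\<close>, \<open>x\<close>, \<open>x + 1\<close>, \<open>x + 2\<close>;
  \<open>C3\<close>, \<open>D3\<close> (pole at \<open>0\<close>), \<open>1 / Lam\<close> and \<open>1 / Phi1\<close> at \<open>x\<close>, \<open>x + 1\<close>; and \<open>1 / Xi1\<close> at \<open>x\<close>.
\<close>

definition coeffs_defined :: "real \<Rightarrow> nat \<Rightarrow> bool" where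
  "coeffs_defined x n \<longleftrightarrow>
     (lam \<noteq> 0 \<longrightarrow> (\<forall>t \<in> {x - 1, x, x + 1, x + 2}. t \<noteq> c \<and> t \<noteq> c + 1)) \<and>
     (\<forall>t \<in> {x, x + 1}. t \<noteq> 0 \<and> Lam t n \<noteq> 0 \<and> Phi1 t n \<noteq> 0) \<and>
     Xi1 x n \<noteq> 0"

end

end

theory Submission
  imports Defs "HOL-Real_Asymp.Real_Asymp"
begin

text \<open>
  Write \<open>C\<^sub>n\<close> for the Charlier polynomials. Expanding \<open>Q\<^sub>n\<close> in the \<open>C\<^sub>k\<close> gives
  \<open>Q\<^sub>n = C\<^sub>n - \<lambda> \<Delta>Q\<^sub>n(c) \<Sum>\<^bsub>k<n\<^esub> C\<^sub>k \<Delta>C\<^sub>k(c) / \<parallel>C\<^sub>k\<parallel>\<^sup>2\<close>, and the Christoffel-Darboux formula turns the kernel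
  into a combination of \<open>C\<^sub>n\<close> and \<open>C\<^sub>n\<^sub>-\<^sub>1\<close> with rational coefficients. The shift relations for
  \<open>C\<^sub>n\<close> then express \<open>\<Delta>Q\<^sub>n\<close>, \<open>\<nabla>Q\<^sub>n\<close>, \<open>Q\<^sub>n\<^sub>-\<^sub>1\<close> and \<open>\<Delta>Q\<^sub>n\<^sub>-\<^sub>1\<close> in the same way; eliminating \<open>C\<^sub>n\<close>,
  \<open>C\<^sub>n\<^sub>-\<^sub>1\<close> and finally \<open>Q\<^sub>n\<^sub>-\<^sub>1\<close> leaves the difference equation.

  The denominators are rational functions of \<open>x\<close>, so it suffices that none of them is
  identically zero. As \<open>x \<rightarrow> \<infinity>\<close> one has \<open>A1 \<rightarrow> 1\<close> and \<open>x B1 \<rightarrow> \<beta>\<^sub>n \<ge> 0\<close>, whence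
  \<open>Lam \<rightarrow> 1 + \<beta>\<^sub>n\<^sub>-\<^sub>1 / (a (n - 1))\<close>, \<open>x Phi1 \<rightarrow> - (n a + \<beta>\<^sub>n)\<close> and
  \<open>Lam Xi1 \<rightarrow> - (n + \<beta>\<^sub>n / a)\<close>, all of which are nonzero (for \<open>n = 1\<close> the quotient in the first
  limit is \<open>0 / 0\<close>, read as \<open>0\<close>).
\<close>

section \<open>Charlier polynomials\<close>

text \<open>At \<open>n = 0\<close> the truncated index \<open>n - 1\<close> carries the factor
  \<open>real n = 0\<close>, so one formula also covers the clause for \<open>Suc 0\<close>.\<close>

lemma charlier_rec_real:
  "poly (charlier a (Suc n)) x
     = (x - real n - a) * poly (charlier a n) x - real n * a * poly (charlier a (n - 1)) x"
  by (cases n) (simp_all add: algebra_simps)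

lemma degree_lead_coeff_charlier: "degree (charlier a n) = n \<and> lead_coeff (charlier a n) = 1"
proof (induction a n rule: charlier.induct)
  case (3 a n)
  let ?l = "[:- real (Suc n) - a, 1:]"
  have nz: "charlier a (Suc n) \<noteq> 0"
    using 3 by (metis leading_coeff_0_iff zero_neq_one)
  have deg: "degree (?l * charlier a (Suc n)) = Suc (Suc n)"
    using 3 nz by (subst degree_mult_eq) auto
  have low: "degree (smult (real (Suc n) * a) (charlier a n)) < Suc (Suc n)"
    using 3 by (auto simp: le_imp_less_Suc)
  have lc: "lead_coeff (?l * charlier a (Suc n)) = 1"
    using 3 by (subst lead_coeff_mult) auto
  have "charlier a (Suc (Suc n)) = - smult (real (Suc n) * a) (charlier a n) + ?l * charlier a (Suc n)"
    by simp
  moreover have "degree (- smult (real (Suc n) * a) (charlier a n)) < degree (?l * charlier a (Suc n))"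
    using low deg by simp
  ultimately show ?case
    using deg lc degree_add_eq_right lead_coeff_add_le by metis
qed auto

text \<open>Induction along the recurrence: at \<open>x + 1\<close> the two preceding polynomials
  are replaced by the hypotheses, and the recurrence one index lower absorbs the rest.\<close>

lemma charlier_forward_shift:
  "fwd_diff (poly (charlier a n)) x = real n * poly (charlier a (n - 1)) x"
proof (induction a n arbitrary: x rule: charlier.induct)
  case (3 a n)
  have a: "poly (charlier a (Suc n)) (x + 1)
      = poly (charlier a (Suc n)) x + real (Suc n) * poly (charlier a n) x"
    and b: "poly (charlier a n) (x + 1)
      = poly (charlier a n) x + real n * poly (charlier a (n - 1)) x"
    using 3[of x] by (simp_all add: fwd_diff_def algebra_simps)
  have c: "poly (charlier a (Suc n)) x
     = (x - real n - a) * poly (charlier a n) x - real n * a * poly (charlier a (n - 1)) x"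
    by (rule charlier_rec_real)
  show ?case
    unfolding fwd_diff_def charlier_rec_real[of a "Suc n"]
    unfolding diff_Suc_1 a b c by (simp add: algebra_simps)
qed (auto simp: fwd_diff_def)

text \<open>The raising relation. In the induction step the forward shift at \<open>x - 1\<close>
  brings in x C_n(x - 1), which the hypothesis evaluates; the recurrence finishes.\<close>

lemma charlier_backward_shift:
  "poly (charlier a (Suc n)) x = x * poly (charlier a n) (x - 1) - a * poly (charlier a n) x"
proof (induction n)
  case (Suc n)
  have "poly (charlier a (Suc n)) x - poly (charlier a (Suc n)) (x - 1)
      = real (Suc n) * poly (charlier a n) (x - 1)"
    using charlier_forward_shift[of a "Suc n" "x - 1"] by (simp add: fwd_diff_def)
  then have "x * poly (charlier a (Suc n)) (x - 1) = x * poly (charlier a (Suc n)) x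
      - real (Suc n) * (x * poly (charlier a n) (x - 1))"
    by (simp add: algebra_simps)
  also have "x * poly (charlier a n) (x - 1)
      = poly (charlier a (Suc n)) x + a * poly (charlier a n) x"
    using Suc by simp
  finally show ?case
    using charlier_rec_real[of a "Suc n" x] by (simp add: algebra_simps)
qed (simp add: algebra_simps)

section \<open>Poisson expectations of polynomials and orthogonality\<close>

lemma power_le_fact_exp: "real k ^ m \<le> fact m * exp (real k)"
proof -
  have "summable (\<lambda>n. real k ^ n /\<^sub>R fact n)" by (rule summable_exp_generic)
  then have "(\<Sum>n\<in>{m}. real k ^ n /\<^sub>R fact n) \<le> (\<Sum>n. real k ^ n /\<^sub>R fact n)"
    by (intro sum_le_suminf) auto
  then have "real k ^ m / fact m \<le> exp (real k)"
    by (simp add: exp_def divide_inverse scaleR_conv_of_real mult.commute)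
  then show ?thesis by (simp add: field_simps)
qed

lemma integrable_poisson_iff:
  fixes f :: "nat \<Rightarrow> real"
  assumes "a > 0"
  shows "integrable (measure_pmf (poisson_pmf a)) f
     \<longleftrightarrow> summable (\<lambda>k. \<bar>f k\<bar> * (a ^ k / fact k))"
proof -
  have "integrable (measure_pmf (poisson_pmf a)) f
     \<longleftrightarrow> summable (\<lambda>k. exp (- a) * (\<bar>f k\<bar> * (a ^ k / fact k)))"
    using assms
    by (simp add: measure_pmf_eq_density integrable_density integrable_count_space_nat_iff
        abs_mult mult_ac)
  also have "\<dots> \<longleftrightarrow> summable (\<lambda>k. \<bar>f k\<bar> * (a ^ k / fact k))"
    by (rule trans[OF summable_cmult_iff]) simp
  finally show ?thesis .
qed

lemma poisson_expectation_suminf: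
  fixes f :: "nat \<Rightarrow> real"
  assumes "a > 0" "integrable (measure_pmf (poisson_pmf a)) f"
  shows "(\<lambda>k. f k * (a ^ k / fact k * exp (- a))) sums measure_pmf.expectation (poisson_pmf a) f"
proof -
  have "integrable (count_space UNIV) (\<lambda>k. pmf (poisson_pmf a) k *\<^sub>R f k)"
    using assms(2) by (simp add: measure_pmf_eq_density integrable_density)
  then have "(\<lambda>k. pmf (poisson_pmf a) k *\<^sub>R f k) sums
      (\<integral>k. pmf (poisson_pmf a) k *\<^sub>R f k \<partial>count_space UNIV)"
    by (rule sums_integral_count_space_nat)
  also have "(\<integral>k. pmf (poisson_pmf a) k *\<^sub>R f k \<partial>count_space UNIV)
      = measure_pmf.expectation (poisson_pmf a) f"
    by (simp add: measure_pmf_eq_density integral_density)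
  finally show ?thesis
    using assms(1) by (simp add: mult_ac)
qed

text \<open>Monomials suffice. Since k^m \<le> m! e^k, the series of the m-th moment is dominated by
  m! times the exponential series of e a.\<close>

lemma integrable_poisson_poly:
  assumes "a > 0"
  shows "integrable (measure_pmf (poisson_pmf a)) (\<lambda>k. poly p (real k))"
proof -
  have "integrable (measure_pmf (poisson_pmf a)) (\<lambda>k. real k ^ m)" for m
    unfolding integrable_poisson_iff[OF assms]
  proof (rule summable_comparison_test)
    have "\<bar>real k ^ m\<bar> * (a ^ k / fact k) \<le> fact m * ((exp 1 * a) ^ k /\<^sub>R fact k)" for k
    proof -
      have "\<bar>real k ^ m\<bar> * (a ^ k / fact k) \<le> fact m * exp (real k) * (a ^ k / fact k)"
        using power_le_fact_exp[of k m] assms by (intro mult_right_mono) auto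
      also have "exp (real k) = exp 1 ^ k"
        using exp_of_nat_mult[of k "1::real"] by simp
      finally show ?thesis
        by (simp add: power_mult_distrib divide_inverse mult_ac)
    qed
    then show "\<exists>N. \<forall>k\<ge>N. norm (\<bar>real k ^ m\<bar> * (a ^ k / fact k))
        \<le> fact m * ((exp 1 * a) ^ k /\<^sub>R fact k)"
      using assms by auto
    show "summable (\<lambda>k. fact m * ((exp 1 * a) ^ k /\<^sub>R fact k))"
      by (intro summable_mult summable_exp_generic)
  qed
  then show ?thesis
    unfolding poly_altdef by (intro Bochner_Integration.integrable_sum) simp
qed

text \<open>Rests on k a^k / k! = a a^(k-1) / (k-1)!, a shift of the summation index.\<close>

lemma poisson_shift:
  assumes "a > 0"
  shows "measure_pmf.expectation (poisson_pmf a) (\<lambda>k. real k * poly p (real k))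
       = a * measure_pmf.expectation (poisson_pmf a) (\<lambda>k. poly p (real k + 1))"
proof -
  have i1: "integrable (measure_pmf (poisson_pmf a)) (\<lambda>k. real k * poly p (real k))"
    using integrable_poisson_poly[OF assms, of "[:0, 1:] * p"] by simp
  have i2: "integrable (measure_pmf (poisson_pmf a)) (\<lambda>k. poly p (real k + 1))"
    using integrable_poisson_poly[OF assms, of "pcompose p [:1, 1:]"]
    by (simp add: poly_pcompose add.commute)
  note s1 = poisson_expectation_suminf[OF assms i1]
  note s2 = sums_mult[OF poisson_expectation_suminf[OF assms i2], of a]
  have "(\<lambda>k. real (Suc k) * poly p (real (Suc k)) * (a ^ Suc k / fact (Suc k) * exp (- a)))
      = (\<lambda>k. a * (poly p (real k + 1) * (a ^ k / fact k * exp (- a))))"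
  proof
    fix k
    have "real (Suc k) * (a ^ Suc k / fact (Suc k)) = a * (a ^ k / fact k)"
      by (simp add: divide_simps)
    then show "real (Suc k) * poly p (real (Suc k)) * (a ^ Suc k / fact (Suc k) * exp (- a))
      = a * (poly p (real k + 1) * (a ^ k / fact k * exp (- a)))"
      by (metis (no_types, opaque_lifting) add.commute mult.assoc mult.commute of_nat_Suc)
  qed
  with s2 have "(\<lambda>k. real (Suc k) * poly p (real (Suc k))
       * (a ^ Suc k / fact (Suc k) * exp (- a))) sums
       (a * measure_pmf.expectation (poisson_pmf a) (\<lambda>k. poly p (real k + 1)))"
    by simp
  \<comment> \<open>The term with k = 0 vanishes, so reindexing loses nothing.\<close>
  then have "(\<lambda>k. real k * poly p (real k) * (a ^ k / fact k * exp (- a))) sums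
       (a * measure_pmf.expectation (poisson_pmf a) (\<lambda>k. poly p (real k + 1)))"
    by (subst (asm) sums_Suc_iff) simp
  with s1 show ?thesis by (rule sums_unique2)
qed

lemma charlier_ip_sum_left:
  assumes "a > 0"
  shows "charlier_ip a (\<Sum>k\<in>A. smult (f k) (P k)) q = (\<Sum>k\<in>A. f k * charlier_ip a (P k) q)"
proof -
  have "integrable (measure_pmf (poisson_pmf a)) (\<lambda>k. poly (P i) (real k) * poly q (real k))" for i
    using integrable_poisson_poly[OF assms, of "P i * q"] by simp
  then show ?thesis
    unfolding charlier_ip_def
    by (simp add: poly_sum sum_distrib_right mult.assoc Bochner_Integration.integral_sum)
qed

lemma charlier_ip_commute: "charlier_ip a p q = charlier_ip a q p"
  by (simp add: charlier_ip_def mult.commute)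

text \<open>Summation by parts: under the Poisson weight the raising operator p(x) -> x p(x - 1) - a
  p(x) is a times the adjoint of \<Delta>. In the proof, \<open>poisson_shift\<close> turns x r(x)
  into a r(x + 1) = a C_n(x) q(x + 1).\<close>

lemma charlier_ip_Suc:
  assumes "a > 0" "\<And>x. poly q' x = fwd_diff (poly q) x"
  shows "charlier_ip a (charlier a (Suc n)) q = a * charlier_ip a (charlier a n) q'"
proof -
  let ?E = "measure_pmf.expectation (poisson_pmf a)"
  let ?C = "charlier a n"
  define r where "r = pcompose ?C [:- 1, 1:] * q"
  have int: "integrable (measure_pmf (poisson_pmf a)) (\<lambda>k. poly p (real k))" for p
    by (rule integrable_poisson_poly[OF assms(1)])
  have r: "poly r x = poly ?C (x - 1) * poly q x" for x
    by (simp add: r_def poly_pcompose)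
  have "charlier_ip a (charlier a (Suc n)) q
      = ?E (\<lambda>k. real k * poly r (real k) - a * (poly ?C (real k) * poly q (real k)))"
    unfolding charlier_ip_def charlier_backward_shift r by (simp add: algebra_simps)
  also have "\<dots> = ?E (\<lambda>k. real k * poly r (real k)) - ?E (\<lambda>k. a * (poly ?C (real k) * poly q (real k)))"
    using int[of "[:0,1:] * r"] int[of "smult a (?C * q)"]
    by (intro Bochner_Integration.integral_diff) (simp_all add: mult.assoc)
  also have "\<dots> = a * (?E (\<lambda>k. poly r (real k + 1)) - ?E (\<lambda>k. poly ?C (real k) * poly q (real k)))"
    by (simp add: poisson_shift[OF assms(1)] algebra_simps)
  also have "?E (\<lambda>k. poly r (real k + 1)) - ?E (\<lambda>k. poly ?C (real k) * poly q (real k))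
      = ?E (\<lambda>k. poly r (real k + 1) - poly ?C (real k) * poly q (real k))"
    using int[of "pcompose r [:1,1:]"] int[of "?C * q"]
    by (intro Bochner_Integration.integral_diff[symmetric])
       (simp_all add: poly_pcompose add.commute)
  also have "\<dots> = charlier_ip a ?C q'"
    unfolding charlier_ip_def assms(2) r fwd_diff_def by (simp add: algebra_simps)
  finally show ?thesis .
qed

text \<open>Each use of \<open>charlier_ip_Suc\<close> lowers both indices and contributes a factor
  a m. The product of 1 with C_m vanishes for m > 0 because \<Delta>1 = 0.\<close>

lemma charlier_orthogonal:
  assumes "a > 0"
  shows "charlier_ip a (charlier a n) (charlier a m) = (if n = m then fact n * a ^ n else 0)"
proof (induction n arbitrary: m)
  case 0
  show ?case
  proof (cases m)
    case (Suc k)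
    have "charlier_ip a (charlier a (Suc k)) 1 = a * charlier_ip a (charlier a k) 0"
      using assms by (intro charlier_ip_Suc) (simp_all add: fwd_diff_def)
    then show ?thesis
      using Suc by (subst charlier_ip_commute) (simp add: charlier_ip_def)
  qed (simp add: charlier_ip_def)
next
  case (Suc n)
  have "charlier_ip a (charlier a (Suc n)) (charlier a m)
      = a * charlier_ip a (charlier a n) (smult (real m) (charlier a (m - 1)))"
    using assms by (intro charlier_ip_Suc) (simp_all add: charlier_forward_shift)
  also have "charlier_ip a (charlier a n) (smult (real m) (charlier a (m - 1)))
      = real m * charlier_ip a (charlier a n) (charlier a (m - 1))"
    by (simp add: charlier_ip_def mult.left_commute)
  finally show ?case
    using Suc[of "m - 1"] by (cases m) auto
qed

section \<open>Christoffel-Darboux formula and expansion in monic bases\<close>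

lemma charlier_Christoffel_Darboux:
  assumes "a > 0"
  shows "(x - y) * (\<Sum>k\<le>n. poly (charlier a k) x * poly (charlier a k) y / (fact k * a ^ k))
     = (poly (charlier a (Suc n)) x * poly (charlier a n) y
        - poly (charlier a n) x * poly (charlier a (Suc n)) y) / (fact n * a ^ n)"
proof (induction n)
  case (Suc n)
  define h where "h = fact n * a ^ n"
  have h: "h \<noteq> 0" "fact (Suc n) * a ^ Suc n = real (Suc n) * a * h"
    using assms by (simp_all add: h_def algebra_simps)
  define u v u' v' where "u = poly (charlier a (Suc n)) x" "v = poly (charlier a (Suc n)) y"
    "u' = poly (charlier a n) x" "v' = poly (charlier a n) y"
  have nz: "real (Suc n) * a \<noteq> 0"
    using assms by simp
  have "(x - y) * (\<Sum>k\<le>Suc n. poly (charlier a k) x * poly (charlier a k) y / (fact k * a ^ k))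
     = (u * v' - u' * v) / h + (x - y) * (u * v / (real (Suc n) * a * h))"
    using Suc unfolding sum.atMost_Suc h(2) u_v_u'_v'_def
    by (simp add: distrib_left h_def del: charlier.simps)
  also have "\<dots> = (real (Suc n) * a * (u * v' - u' * v) + (x - y) * (u * v)) / (real (Suc n) * a * h)"
    using nz h(1) by (simp add: add_divide_distrib del: of_nat_Suc)
  \<comment> \<open>The factor x - y is split so that the recurrence at x and at y produces the
    polynomials of index n + 2.\<close>
  also have "real (Suc n) * a * (u * v' - u' * v) + (x - y) * (u * v)
     = ((x - real (Suc n) - a) * u - real (Suc n) * a * u') * v
       - u * ((y - real (Suc n) - a) * v - real (Suc n) * a * v')"
    by (simp add: algebra_simps)
  finally show ?case
    unfolding charlier_rec_real[of a "Suc n"] h(2) u_v_u'_v'_def by simp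
qed simp

text \<open>Subtracting the leading multiple of \<open>P n\<close> lowers the degree bound. The top
  coefficient is recorded because it becomes the 1 in front of C_n in
  \<open>Q_expansion\<close>.\<close>

lemma monic_basis_expansion:
  fixes P :: "nat \<Rightarrow> real poly"
  assumes "\<And>k. degree (P k) = k \<and> lead_coeff (P k) = 1" "degree p \<le> n"
  shows "\<exists>f. p = (\<Sum>k\<le>n. smult (f k) (P k)) \<and> f n = coeff p n"
  using assms(2)
proof (induction n arbitrary: p)
  case 0
  have "P 0 = 1"
    using assms(1)[of 0] by (auto elim!: degree_eq_zeroE simp: one_pCons)
  moreover obtain b where "p = [:b:]"
    using 0 degree_eq_zeroE by blast
  ultimately show ?case
    by (intro exI[of _ "\<lambda>_. b"]) simp
next
  case (Suc n)
  define r where "r = p - smult (coeff p (Suc n)) (P (Suc n))"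
  have lc: "coeff (P (Suc n)) (Suc n) = 1"
    using assms(1)[of "Suc n"] by metis
  have "degree r \<le> Suc n"
    unfolding r_def using Suc.prems assms(1)[of "Suc n"]
    by (intro degree_diff_le) (auto intro: order.trans[OF degree_smult_le])
  moreover have "coeff r (Suc n) = 0"
    by (simp add: r_def lc)
  ultimately have "degree r \<le> n"
    by (metis le_SucE leading_coeff_0_iff degree_0 le0)
  then obtain f where f: "r = (\<Sum>k\<le>n. smult (f k) (P k))"
    using Suc.IH by blast
  show ?case
    using f
    by (intro exI[of _ "f(Suc n := coeff p (Suc n))"])
       (auto simp: r_def algebra_simps intro!: sum.cong)
qed

section \<open>Connection with the Charlier polynomials\<close>

locale sobolev_charlier =
  fixes a c lam :: real and Q :: "nat \<Rightarrow> real poly"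
  assumes a_pos: "a > 0" and lam_nonneg: "lam \<ge> 0"
    and orth: "monic_orthogonal_seq (sobolev_ip a c lam) Q"
begin

lemma monic_Q: "degree (Q n) = n \<and> lead_coeff (Q n) = 1"
  using orth unfolding monic_orthogonal_seq_def by blast

lemma sobolev_ip_Q_lower:
  assumes "degree p < n"
  shows "sobolev_ip a c lam (Q n) p = 0"
proof -
  obtain f where f: "p = (\<Sum>k\<le>degree p. smult (f k) (Q k))"
    using monic_basis_expansion[OF monic_Q order.refl] by blast
  have "sobolev_ip a c lam (Q n) (\<Sum>k\<le>d. smult (f k) (Q k))
      = (\<Sum>k\<le>d. f k * sobolev_ip a c lam (Q n) (Q k))" for d
    unfolding sobolev_ip_def charlier_ip_commute[of a "Q n"] charlier_ip_sum_left[OF a_pos]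
    by (simp add: fwd_diff_def poly_sum sum_subtractf[symmetric] sum.distrib[symmetric]
        sum_distrib_left algebra_simps)
  also have "(\<Sum>k\<le>degree p. f k * sobolev_ip a c lam (Q n) (Q k)) = 0"
    using orth assms by (intro sum.neutral) (auto simp: monic_orthogonal_seq_def)
  finally show ?thesis
    using f by metis
qed

text \<open>For m < n, orthogonality of Q_n to C_m in the Sobolev product fixes the coefficient of
  C_m; that of C_n is 1 since both are monic. The number \<Delta>Q_n(c) stays unsolved, as it does
  in \<open>A1\<close> and \<open>B1\<close>.\<close>

lemma Q_expansion:
  "poly (Q n) x = poly (charlier a n) x - lam * fwd_diff (poly (Q n)) c *
     (\<Sum>k<n. poly (charlier a k) x * fwd_diff (poly (charlier a k)) c / (fact k * a ^ k))"
proof -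
  obtain f where f: "Q n = (\<Sum>k\<le>n. smult (f k) (charlier a k))" and "f n = coeff (Q n) n"
    using monic_basis_expansion[of "charlier a" "Q n" n, OF degree_lead_coeff_charlier
        eq_refl[OF conjunct1[OF monic_Q]]]
    by blast
  then have fn: "f n = 1"
    using monic_Q by metis
  have fm: "f m = - lam * fwd_diff (poly (Q n)) c * fwd_diff (poly (charlier a m)) c / (fact m * a ^ m)"
    if "m < n" for m
  proof -
    have "charlier_ip a (Q n) (charlier a m)
        = (\<Sum>k\<le>n. f k * charlier_ip a (charlier a k) (charlier a m))"
      using charlier_ip_sum_left[OF a_pos] f by metis
    also have "\<dots> = (\<Sum>k\<le>n. if k = m then f m * (fact m * a ^ m) else 0)"
      by (intro sum.cong) (auto simp: charlier_orthogonal[OF a_pos])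
    also have "\<dots> = f m * (fact m * a ^ m)"
      using that by simp
    finally have "f m * (fact m * a ^ m)
        + lam * fwd_diff (poly (Q n)) c * fwd_diff (poly (charlier a m)) c = 0"
      using sobolev_ip_Q_lower[of "charlier a m" n] degree_lead_coeff_charlier[of a m] that
      by (simp add: sobolev_ip_def)
    then have "f m * (fact m * a ^ m)
        = - lam * fwd_diff (poly (Q n)) c * fwd_diff (poly (charlier a m)) c"
      by simp
    moreover have "fact m * a ^ m \<noteq> 0"
      using a_pos by simp
    ultimately show ?thesis
      by (metis nonzero_eq_divide_eq)
  qed
  have "poly (Q n) x = (\<Sum>k\<le>n. f k * poly (charlier a k) x)"
    by (subst f) (simp add: poly_sum)
  also have "\<dots> = poly (charlier a n) x + (\<Sum>k<n. f k * poly (charlier a k) x)"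
    using fn by (simp add: lessThan_Suc_atMost[symmetric])
  also have "(\<Sum>k<n. f k * poly (charlier a k) x) = - lam * fwd_diff (poly (Q n)) c *
     (\<Sum>k<n. poly (charlier a k) x * fwd_diff (poly (charlier a k)) c / (fact k * a ^ k))"
    unfolding sum_distrib_left by (intro sum.cong) (simp_all add: fm)
  finally show ?thesis by simp
qed

lemma charlier_ip_self: "charlier_ip a (charlier a n) (charlier a n) = fact n * a ^ n"
  by (simp add: charlier_orthogonal[OF a_pos])

text \<open>The nonnegativity of the kernel on the diagonal keeps the leading coefficients in the
  asymptotics of \<^term>\<open>Lam\<close>, \<^term>\<open>Phi1\<close> and \<^term>\<open>Xi1\<close> away from zero.\<close>

lemma fwd_diff_Q_charlier_nonneg:
  "fwd_diff (poly (Q n)) c * fwd_diff (poly (charlier a n)) c \<ge> 0"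
proof -
  define K where
    "K = (\<Sum>k<n. (fwd_diff (poly (charlier a k)) c)\<^sup>2 / (fact k * a ^ k))"
  let ?d = "fwd_diff (poly (Q n)) c"
  have "K \<ge> 0"
    unfolding K_def using a_pos by (intro sum_nonneg) auto
  have "fwd_diff (\<lambda>x. \<Sum>k<n. poly (charlier a k) x * fwd_diff (poly (charlier a k)) c / (fact k * a ^ k)) c = K"
    unfolding K_def fwd_diff_def sum_subtractf[symmetric]
    by (intro sum.cong) (simp_all add: power2_eq_square diff_divide_distrib[symmetric] left_diff_distrib)
  \<comment> \<open>Taking \<Delta> at c in \<open>Q_expansion\<close> gives a linear equation for
    \<Delta>Q_n(c).\<close>
  then have "?d = fwd_diff (poly (charlier a n)) c - lam * ?d * K"
    unfolding fwd_diff_def by (subst (1 2) Q_expansion) (simp add: algebra_simps fwd_diff_def)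
  then have "fwd_diff (poly (charlier a n)) c = ?d * (1 + lam * K)"
    by (simp add: algebra_simps)
  then have "?d * fwd_diff (poly (charlier a n)) c = ?d\<^sup>2 * (1 + lam * K)"
    by (simp add: power2_eq_square)
  then show ?thesis
    using \<open>K \<ge> 0\<close> lam_nonneg by simp
qed

abbreviation regular :: "real \<Rightarrow> bool" where
  "regular x \<equiv> (lam \<noteq> 0 \<longrightarrow> x \<noteq> c \<and> x \<noteq> c + 1)"

lemma A1_0 [simp]: "A1 a c lam Q x 0 = 1" and B1_0 [simp]: "B1 a c lam Q x 0 = 0"
proof -
  obtain b where "Q 0 = [:b:]"
    using monic_Q[of 0] by (auto elim!: degree_eq_zeroE)
  then have "fwd_diff (poly (Q 0)) c = 0"
    by (simp add: fwd_diff_def)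
  then show "A1 a c lam Q x 0 = 1" "B1 a c lam Q x 0 = 0"
    by (simp_all add: A1_def B1_def)
qed

text \<open>The kernel differenced in its second variable is a difference of two Christoffel-Darboux
  sums, at c + 1 and at c. For \<open>n = 0\<close> the truncated index is harmless because
  \<open>B1\<close> vanishes.\<close>

lemma Q_connection:
  assumes "regular x"
  shows "poly (Q n) x = A1 a c lam Q x n * poly (charlier a n) x
      + B1 a c lam Q x n * poly (charlier a (n - 1)) x"
proof (cases "n = 0 \<or> lam = 0")
  case True
  then show ?thesis
    by (subst Q_expansion) (auto simp: A1_def[of _ _ 0] B1_def[of _ _ 0])
next
  case False
  then obtain m where n: "n = Suc m"
    by (cases n) auto
  from False assms have x: "x - c \<noteq> 0" "x - c - 1 \<noteq> 0"
    by auto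
  define h where "h = fact m * a ^ m"
  have "h \<noteq> 0"
    using a_pos by (simp add: h_def)
  define S where "S y = (\<Sum>k\<le>m. poly (charlier a k) x * poly (charlier a k) y / (fact k * a ^ k))" for y
  define u v where "u = poly (charlier a n) x" "v = poly (charlier a m) x"
  define p q where "p = poly (charlier a n)" "q = poly (charlier a m)"
  define U V where "U = (q c + (x - c) * fwd_diff q c) / ((x - c) * (x - c - 1))"
    "V = (p c + (x - c) * fwd_diff p c) / ((x - c) * (x - c - 1))"
  have S: "S y = (u * q y - v * p y) / h / (x - y)" if "x - y \<noteq> 0" for y
    using charlier_Christoffel_Darboux[OF a_pos, of x y m] that
    unfolding S_def[symmetric] u_v_def p_q_def h_def n
    by (metis nonzero_mult_div_cancel_left)
  have "(\<Sum>k<n. poly (charlier a k) x * fwd_diff (poly (charlier a k)) c / (fact k * a ^ k))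
      = S (c + 1) - S c"
    unfolding n S_def fwd_diff_def sum_subtractf[symmetric]
    by (intro sum.cong) (auto simp: right_diff_distrib diff_divide_distrib)
  also have "\<dots> = (u * q (c + 1) - v * p (c + 1)) / h / (x - c - 1) - (u * q c - v * p c) / h / (x - c)"
    using x S[of c] S[of "c + 1"] by (simp add: algebra_simps)
  \<comment> \<open>Common denominator: (x - c) q(c + 1) - (x - c - 1) q(c) = q(c) + (x - c)
    \<Delta>q(c), and likewise for p.\<close>
  also have "\<dots> = (u * U - v * V) / h"
    using x \<open>h \<noteq> 0\<close> unfolding fwd_diff_def U_V_def by (simp add: divide_simps) (simp add: algebra_simps)
  finally have "poly (Q n) x = u - lam * fwd_diff (poly (Q n)) c * ((u * U - v * V) / h)"
    by (subst Q_expansion) (simp add: u_v_def)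
  moreover have A: "A1 a c lam Q x n = 1 - lam * (fwd_diff (poly (Q n)) c / h) * U"
    by (simp add: A1_def charlier_ip_self n h_def p_q_def U_V_def)
  moreover have B: "B1 a c lam Q x n = lam * (fwd_diff (poly (Q n)) c / h) * V"
    by (simp add: B1_def charlier_ip_self n h_def p_q_def U_V_def)
  ultimately show ?thesis
    unfolding A B
    by (simp add: n u_v_def algebra_simps diff_divide_distrib)
qed

section \<open>Coefficient functions from the shift relations\<close>

lemma charlier_plus1:
  assumes "n \<ge> 1"
  shows "poly (charlier a n) (x + 1) = poly (charlier a n) x + real n * poly (charlier a (n - 1)) x"
    and "poly (charlier a (n - 1)) (x + 1)
      = - poly (charlier a n) x / a + (x - real n + 1) / a * poly (charlier a (n - 1)) x"
proof -
  show "poly (charlier a n) (x + 1) = poly (charlier a n) x + real n * poly (charlier a (n - 1)) x"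
    using charlier_forward_shift[of a n x] by (simp add: fwd_diff_def)
  obtain m where n: "n = Suc m"
    using assms by (cases n) auto
  have "poly (charlier a m) (x + 1)
      = poly (charlier a m) x + real m * poly (charlier a (m - 1)) x"
    using charlier_forward_shift[of a m x] by (simp add: fwd_diff_def)
  \<comment> \<open>The recurrence trades C_(m-1) for C_m and C_(m+1), which keeps C_n, C_(n-1) as
    the basis.\<close>
  moreover have "real m * poly (charlier a (m - 1)) x
      = ((x - real m - a) * poly (charlier a m) x - poly (charlier a (Suc m)) x) / a"
    using charlier_rec_real[of a m x] a_pos by (simp add: field_simps)
  ultimately show "poly (charlier a (n - 1)) (x + 1)
      = - poly (charlier a n) x / a + (x - real n + 1) / a * poly (charlier a (n - 1)) x"
    using a_pos by (simp add: n diff_divide_distrib add_divide_distrib left_diff_distrib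
        distrib_right del: charlier.simps)
qed

lemma charlier_minus1:
  assumes "n \<ge> 1" "x \<noteq> 0"
  shows "poly (charlier a n) (x - 1) = poly (charlier a n) x
      - real n / x * poly (charlier a n) x - real n * a / x * poly (charlier a (n - 1)) x"
    and "poly (charlier a (n - 1)) (x - 1)
      = 1 / x * poly (charlier a n) x + a / x * poly (charlier a (n - 1)) x"
proof -
  obtain m where n: "n = Suc m"
    using assms by (cases n) auto
  show *: "poly (charlier a (n - 1)) (x - 1)
      = 1 / x * poly (charlier a n) x + a / x * poly (charlier a (n - 1)) x"
    using charlier_backward_shift[of a m x] assms by (simp add: n field_simps del: charlier.simps)
  have "poly (charlier a n) (x - 1) = poly (charlier a n) x - real n * poly (charlier a (n - 1)) (x - 1)"
    using charlier_forward_shift[of a n "x - 1"] by (simp add: fwd_diff_def)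
  then show "poly (charlier a n) (x - 1) = poly (charlier a n) x
      - real n / x * poly (charlier a n) x - real n * a / x * poly (charlier a (n - 1)) x"
    unfolding * by (simp add: distrib_left)
qed

lemma fwd_diff_Q:
  assumes "regular x" "regular (x + 1)" "n \<ge> 1"
  shows "fwd_diff (poly (Q n)) x = C1 a c lam Q x n * poly (charlier a n) x
      + D1 a c lam Q x n * poly (charlier a (n - 1)) x"
  unfolding fwd_diff_def Q_connection[OF assms(1)] Q_connection[OF assms(2)]
    charlier_plus1[OF assms(3)] C1_def D1_def
  by (simp add: algebra_simps)

lemma bwd_diff_Q:
  assumes "regular x" "regular (x - 1)" "x \<noteq> 0" "n \<ge> 1"
  shows "bwd_diff (poly (Q n)) x = C3 a c lam Q x n * poly (charlier a n) x
      + D3 a c lam Q x n * poly (charlier a (n - 1)) x"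
  unfolding bwd_diff_def Q_connection[OF assms(1)] Q_connection[OF assms(2)]
    charlier_minus1[OF assms(4,3)] C3_def D3_def
  using assms(3) by (simp add: field_simps)

text \<open>\<open>A2\<close> and \<open>B2\<close> come from \<open>Q_connection\<close> at n - 1
  by eliminating C_(n-2) with the recurrence. For n = 1 they are 0 and 1.\<close>

lemma Q_pred_connection:
  assumes "regular x" "n \<ge> 1"
  shows "poly (Q (n - 1)) x = A2 a c lam Q x n * poly (charlier a n) x
      + B2 a c lam Q x n * poly (charlier a (n - 1)) x"
proof (cases "n = 1")
  case True
  then show ?thesis
    using Q_connection[OF assms(1), of 0] by (simp add: A2_def B2_def)
next
  case False
  with assms obtain m where n: "n = Suc (Suc m)"
    by (metis One_nat_def Suc_le_D not0_implies_Suc)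
  have "real (Suc m) * a * poly (charlier a m) x
      = (x - real (Suc m) - a) * poly (charlier a (Suc m)) x - poly (charlier a n) x"
    unfolding n using charlier_rec_real[of a "Suc m" x] by simp
  then have C: "poly (charlier a m) x
      = ((x - real (Suc m) - a) * poly (charlier a (Suc m)) x - poly (charlier a n) x) / (a * real (Suc m))"
    using a_pos by (simp add: eq_divide_eq mult.commute del: charlier.simps of_nat_Suc)
  have "poly (Q (Suc m)) x = A1 a c lam Q x (Suc m) * poly (charlier a (Suc m)) x
      + B1 a c lam Q x (Suc m) * poly (charlier a m) x"
    using Q_connection[OF assms(1), of "Suc m"] by simp
  moreover have "real n - 1 = real (Suc m)"
    by (simp add: n)
  ultimately show ?thesis
    unfolding C A2_def B2_def
    by (simp add: n diff_divide_distrib algebra_simps add_divide_distrib del: charlier.simps)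
qed

lemma fwd_diff_Q_pred:
  assumes "regular x" "regular (x + 1)" "n \<ge> 1"
  shows "fwd_diff (poly (Q (n - 1))) x = C2 a c lam Q x n * poly (charlier a n) x
      + D2 a c lam Q x n * poly (charlier a (n - 1)) x"
proof -
  obtain m where n: "n = Suc m"
    using assms(3) by (cases n) auto
  \<comment> \<open>\<open>C2\<close> and \<open>D2\<close> arise from \<open>A2\<close> and
    \<open>B2\<close> as \<open>C1\<close> and \<open>D1\<close> do from \<open>A1\<close> and
    \<open>B1\<close>. For \<open>m = 0\<close> the quotients by \<open>n - 1\<close> have numerator
    0.\<close>
  have CD: "C2 a c lam Q x n = A2 a c lam Q (x + 1) n - B2 a c lam Q (x + 1) n / a - A2 a c lam Q x n
    \<and> D2 a c lam Q x n = real n * A2 a c lam Q (x + 1) n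
      + (x - real n + 1) / a * B2 a c lam Q (x + 1) n - B2 a c lam Q x n"
  proof (cases m)
    case 0
    then show ?thesis
      by (simp add: n C2_def D2_def A2_def B2_def)
  next
    case (Suc k)
    define N where "N = real m"
    have "N \<noteq> 0" "real n - 1 = N" "real n = N + 1"
      using Suc by (simp_all add: N_def n)
    then show ?thesis
      using a_pos unfolding C2_def D2_def A2_def B2_def
      by (simp add: field_simps power2_eq_square)
  qed
  show ?thesis
    unfolding conjunct1[OF CD] conjunct2[OF CD]
      fwd_diff_def Q_pred_connection[OF assms(1,3)] Q_pred_connection[OF assms(2,3)]
      charlier_plus1[OF assms(3)]
    by (simp add: algebra_simps)
qed

end

section \<open>The difference equation\<close>

text \<open>Cramer's rule, with \<open>L\<close> the determinant of the passage from (u, v) to (y1,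
  y2). Kept in product form because \<open>Q_pred_lowering\<close> divides by \<open>Phi1\<close>
  rather than by \<open>L\<close>.\<close>

lemma eliminate_pair:
  fixes u v :: real
  assumes "L = p1 * q2 - q1 * p2" "y1 = p1 * u + q1 * v" "y2 = p2 * u + q2 * v"
    "d = r * u + s * v"
  shows "L * d = (r * q2 - p2 * s) * y1 - (r * q1 - p1 * s) * y2"
  unfolding assms by (simp add: algebra_simps)

context sobolev_charlier
begin

lemma fwd_diff_Q_Xi:
  assumes "regular x" "regular (x + 1)" "n \<ge> 1" "Lam a c lam Q x n \<noteq> 0"
  shows "fwd_diff (poly (Q n)) x = Xi2 a c lam Q x n * poly (Q n) x
      - Xi1 a c lam Q x n * poly (Q (n - 1)) x"
proof -
  have "Lam a c lam Q x n * fwd_diff (poly (Q n)) x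
      = (C1 a c lam Q x n * B2 a c lam Q x n - A2 a c lam Q x n * D1 a c lam Q x n) * poly (Q n) x
      - (C1 a c lam Q x n * B1 a c lam Q x n - A1 a c lam Q x n * D1 a c lam Q x n)
        * poly (Q (n - 1)) x"
    by (rule eliminate_pair[OF Lam_def Q_connection[OF assms(1)]
          Q_pred_connection[OF assms(1,3)] fwd_diff_Q[OF assms(1-3)]])
  then show ?thesis
    using assms(4) unfolding Xi1_def Xi2_def
    by (metis (no_types, lifting) diff_divide_distrib nonzero_mult_div_cancel_left times_divide_eq_left)
qed

lemma fwd_diff_Q_pred_Theta:
  assumes "regular x" "regular (x + 1)" "n \<ge> 1" "Lam a c lam Q x n \<noteq> 0"
  shows "fwd_diff (poly (Q (n - 1))) x = Theta2 a c lam Q x n * poly (Q n) x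
      - Theta1 a c lam Q x n * poly (Q (n - 1)) x"
proof -
  have "Lam a c lam Q x n * fwd_diff (poly (Q (n - 1))) x
      = (C2 a c lam Q x n * B2 a c lam Q x n - A2 a c lam Q x n * D2 a c lam Q x n) * poly (Q n) x
      - (C2 a c lam Q x n * B1 a c lam Q x n - A1 a c lam Q x n * D2 a c lam Q x n)
        * poly (Q (n - 1)) x"
    by (rule eliminate_pair[OF Lam_def Q_connection[OF assms(1)]
          Q_pred_connection[OF assms(1,3)] fwd_diff_Q_pred[OF assms(1-3)]])
  then show ?thesis
    using assms(4) unfolding Theta1_def Theta2_def
    by (metis (no_types, lifting) diff_divide_distrib nonzero_mult_div_cancel_left times_divide_eq_left)
qed

lemma Q_pred_lowering:
  assumes "regular x" "regular (x - 1)" "x \<noteq> 0" "n \<ge> 1" "Phi1 a c lam Q x n \<noteq> 0"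
  shows "poly (Q (n - 1)) x = F1 a c lam Q x n * bwd_diff (poly (Q n)) x
      + G1 a c lam Q x n * poly (Q n) x"
proof -
  have "Lam a c lam Q x n * bwd_diff (poly (Q n)) x
      = Phi2 a c lam Q x n * poly (Q n) x - Phi1 a c lam Q x n * poly (Q (n - 1)) x"
    unfolding Phi1_def Phi2_def
    by (rule eliminate_pair[OF Lam_def Q_connection[OF assms(1)]
          Q_pred_connection[OF assms(1,4)] bwd_diff_Q[OF assms(1-4)]])
  then have "Phi1 a c lam Q x n * poly (Q (n - 1)) x
      = Phi2 a c lam Q x n * poly (Q n) x - Lam a c lam Q x n * bwd_diff (poly (Q n)) x"
    by simp
  then have "poly (Q (n - 1)) x
      = (Phi2 a c lam Q x n * poly (Q n) x - Lam a c lam Q x n * bwd_diff (poly (Q n)) x)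
        / Phi1 a c lam Q x n"
    using assms(5) by (metis nonzero_mult_div_cancel_left)
  then show ?thesis
    by (simp add: F1_def G1_def diff_divide_distrib)
qed

text \<open>Inserting \<open>Q_pred_lowering\<close> into \<open>fwd_diff_Q_Xi\<close> removes
  Q_(n-1).\<close>

lemma fwd_diff_Q_bwd_diff:
  assumes "regular x" "regular (x - 1)" "regular (x + 1)" "x \<noteq> 0" "n \<ge> 1"
    "Lam a c lam Q x n \<noteq> 0" "Phi1 a c lam Q x n \<noteq> 0"
  shows "fwd_diff (poly (Q n)) x = F2 a c lam Q x n * bwd_diff (poly (Q n)) x
      + G2 a c lam Q x n * poly (Q n) x"
  unfolding fwd_diff_Q_Xi[OF assms(1,3,5,6)] Q_pred_lowering[OF assms(1,2,4,5,7)] F2_def G2_def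
  by (simp add: algebra_simps)

text \<open>Apply \<open>\<Delta>\<close> to the preceding relation and express \<open>\<Delta>\<Delta> Q\<^sub>n\<close>, which then appears on its
  left-hand side, through \<^term>\<open>Xi1\<close>, \<^term>\<open>Xi2\<close>, \<^term>\<open>Theta1\<close>, \<^term>\<open>Theta2\<close>:
  this produces \<^term>\<open>R\<close> and \<^term>\<open>S\<close>.\<close>

theorem difference_equation:
  assumes def: "coeffs_defined a c lam Q x n" and n: "n \<ge> 1"
  shows "sigma_coeff a c lam Q x n * fwd_diff (bwd_diff (poly (Q n))) x
       + tau_coeff a c lam Q x n * fwd_diff (poly (Q n)) x
       + mu_coeff a c lam Q x n * poly (Q n) x = 0"
proof -
  let ?q = "poly (Q n)"
  define y y' d d' where "y = ?q x" "y' = poly (Q (n - 1)) x"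
    "d = fwd_diff ?q x" "d' = fwd_diff (poly (Q (n - 1))) x"
  define X1 X1' X2 X2' T1 T2 where "X1 = Xi1 a c lam Q x n" "X1' = Xi1 a c lam Q (x + 1) n"
    "X2 = Xi2 a c lam Q x n" "X2' = Xi2 a c lam Q (x + 1) n"
    "T1 = Theta1 a c lam Q x n" "T2 = Theta2 a c lam Q x n"
  define f f' g g' e where "f = F2 a c lam Q x n" "f' = F2 a c lam Q (x + 1) n"
    "g = G2 a c lam Q x n" "g' = G2 a c lam Q (x + 1) n" "e = bwd_diff ?q x"
  have reg: "regular (x - 1)" "regular x" "regular (x + 1)" "regular (x + 2)"
    and nz: "x \<noteq> 0" "x + 1 \<noteq> 0" "Lam a c lam Q x n \<noteq> 0" "Lam a c lam Q (x + 1) n \<noteq> 0"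
      "Phi1 a c lam Q x n \<noteq> 0" "Phi1 a c lam Q (x + 1) n \<noteq> 0" and X1: "X1 \<noteq> 0"
    using def unfolding coeffs_defined_def X1_X1'_X2_X2'_T1_T2_def by auto
  have plus: "x + 1 + 1 = x + 2" "x + 1 - 1 = x"
    by simp_all
  have q1: "?q (x + 1) = y + d" "poly (Q (n - 1)) (x + 1) = y' + d'"
    by (simp_all add: y_y'_d_d'_def fwd_diff_def)
  have bwd: "bwd_diff ?q (x + 1) = d"
    by (simp add: bwd_diff_def fwd_diff_def y_y'_d_d'_def)
  have d: "d = X2 * y - X1 * y'"
    using fwd_diff_Q_Xi[of x n] reg n nz by (simp add: y_y'_d_d'_def X1_X1'_X2_X2'_T1_T2_def)
  have d': "d' = T2 * y - T1 * y'"
    using fwd_diff_Q_pred_Theta[of x n] reg n nz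
    by (simp add: y_y'_d_d'_def X1_X1'_X2_X2'_T1_T2_def)
  have d1: "fwd_diff ?q (x + 1) = X2' * (y + d) - X1' * (y' + d')"
    using fwd_diff_Q_Xi[of "x + 1" n] reg n nz
    by (simp add: plus q1 X1_X1'_X2_X2'_T1_T2_def del: One_nat_def)
  have d_FG: "d = f * e + g * y"
    using fwd_diff_Q_bwd_diff[of x n] reg n nz by (simp add: y_y'_d_d'_def f_f'_g_g'_e_def)
  have d1_FG: "fwd_diff ?q (x + 1) = f' * d + g' * (y + d)"
    using fwd_diff_Q_bwd_diff[of "x + 1" n] reg n nz
    by (simp add: plus q1 bwd f_f'_g_g'_e_def)
  have y': "y' = (X2 * y - d) / X1"
    using d X1 by (simp add: field_simps)
  define r where "r = (T1 - 1) * (X1' - X1) / X1"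
  have r: "r * (X2 * y - d) = (T1 - 1) * (X1' - X1) * y'"
    by (simp add: r_def y')
  \<comment> \<open>Written with \<open>R\<close> and \<open>S\<close>: R \<Delta>Q_n + S Q_n = -
    \<Delta>\<Delta>Q_n.\<close>
  have RS: "(r - (X2' - X2) + T1 - X2) * d + (T2 * X1' - (X2' - X2) - T1 * X2 - X2 * r) * y
      = d - fwd_diff ?q (x + 1)"
  proof -
    have "(r - (X2' - X2) + T1 - X2) * d + (T2 * X1' - (X2' - X2) - T1 * X2 - X2 * r) * y
      = - (r * (X2 * y - d)) - T1 * (X2 * y - d) - X2' * d + T2 * X1' * y - (X2' - X2) * y"
      by (simp add: algebra_simps)
    also have "X2 * y - d = X1 * y'"
      using d by simp
    also have "r * (X1 * y') = (T1 - 1) * (X1' - X1) * y'"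
      using X1 by (simp add: r_def)
    also have "- ((T1 - 1) * (X1' - X1) * y') - T1 * (X1 * y') - X2' * d + T2 * X1' * y - (X2' - X2) * y
       = X2 * y - X1 * y' - (X2' * (y + d) - X1' * (y' + (T2 * y - T1 * y')))"
      by (simp add: algebra_simps)
    finally show ?thesis
      unfolding d1 d' using d by simp
  qed
  have R: "R a c lam Q x n = r - (X2' - X2) + T1 - X2"
    and S: "S a c lam Q x n = T2 * X1' - (X2' - X2) - T1 * X2 - X2 * r"
    by (simp_all add: R_def S_def r_def X1_X1'_X2_X2'_T1_T2_def fwd_diff_def)
  have "sigma_coeff a c lam Q x n * fwd_diff (bwd_diff ?q) x
       + tau_coeff a c lam Q x n * fwd_diff ?q x + mu_coeff a c lam Q x n * ?q x
      = f * (d - e) + (f' - f + g' + R a c lam Q x n) * d + (g' - g + S a c lam Q x n) * y"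
    unfolding sigma_coeff_def tau_coeff_def mu_coeff_def fwd_diff_def[of "bwd_diff ?q"] bwd
    by (simp add: f_f'_g_g'_e_def y_y'_d_d'_def fwd_diff_def)
  \<comment> \<open>The first two brackets are F2 \<nabla>Q_n + G2 Q_n at x + 1 and at x, hence
    \<Delta>Q_n at these points; the third cancels their difference.\<close>
  also have "\<dots> = (f' * d + g' * (y + d)) - (f * e + g * y)
      + (R a c lam Q x n * d + S a c lam Q x n * y)"
    by (simp add: algebra_simps)
  also have "\<dots> = fwd_diff ?q (x + 1) - d + (d - fwd_diff ?q (x + 1))"
    unfolding R S RS d1_FG[symmetric] d_FG[symmetric] ..
  finally show ?thesis by simp
qed

section \<open>The case \<lambda> = 0\<close>

lemma coeffs_lam_0:
  assumes lam: "lam = 0" and n: "n \<ge> 1" and x: "x \<noteq> 0" "x \<noteq> - 1"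
  shows "sigma_coeff a c lam Q x n = x / a" "tau_coeff a c lam Q x n = (a - x) / a"
    "mu_coeff a c lam Q x n = real n / a"
proof -
  have A: "A1 a c lam Q t k = 1" "B1 a c lam Q t k = 0" for t k
    by (simp_all add: A1_def B1_def lam)
  have A2: "A2 a c lam Q t n = 0" "B2 a c lam Q t n = 1" for t
    by (simp_all add: A2_def B2_def A)
  have C: "C1 a c lam Q t n = 0" "D1 a c lam Q t n = real n"
      "C3 a c lam Q t n = real n / t" "D3 a c lam Q t n = real n * a / t"
      "C2 a c lam Q t n = - 1 / a" "D2 a c lam Q t n = (t + 1 - real n) / a - 1" for t
    by (simp_all add: C1_def D1_def C2_def D2_def C3_def D3_def bwd_diff_def A algebra_simps)
  have X: "Lam a c lam Q t n = 1" "Xi1 a c lam Q t n = - real n" "Xi2 a c lam Q t n = 0"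
      "Theta1 a c lam Q t n = 1 - (t + 1 - real n) / a" "Theta2 a c lam Q t n = - 1 / a"
      "Phi1 a c lam Q t n = - (real n * a / t)" "Phi2 a c lam Q t n = real n / t" for t
    by (simp_all add: Lam_def Xi1_def Xi2_def Theta1_def Theta2_def Phi1_def Phi2_def A A2 C)
  \<comment> \<open>Used at x and x + 1, hence the exclusion of 0 and -1.\<close>
  have F: "F2 a c lam Q t n = t / a" "G2 a c lam Q t n = - real n / a" if "t \<noteq> 0" for t
    using that n a_pos by (simp_all add: F1_def F2_def G1_def G2_def X)
  have "x + 1 \<noteq> 0"
    using x by linarith
  with x n a_pos show "sigma_coeff a c lam Q x n = x / a" "tau_coeff a c lam Q x n = (a - x) / a"
    "mu_coeff a c lam Q x n = real n / a"
    by (simp_all add: sigma_coeff_def tau_coeff_def mu_coeff_def R_def S_def X F fwd_diff_def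
        diff_divide_distrib add_divide_distrib)
qed

end

text \<open>Derived from the shift relations alone, so it holds at every x, including 0 and -1,
  where the general coefficients are not defined.\<close>

lemma charlier_difference_equation:
  assumes "a \<noteq> 0"
  shows "x * fwd_diff (bwd_diff (poly (charlier a n))) x
          + (a - x) * fwd_diff (poly (charlier a n)) x
          + real n * poly (charlier a n) x = 0"
proof (cases n)
  case (Suc m)
  let ?C = "poly (charlier a n)" and ?D = "poly (charlier a m)"
  have e1: "fwd_diff (bwd_diff ?C) x = real n * (?D x - ?D (x - 1))"
    using charlier_forward_shift[of a n x] charlier_forward_shift[of a n "x - 1"]
    by (simp add: fwd_diff_def bwd_diff_def Suc algebra_simps del: charlier.simps)
  have e2: "fwd_diff ?C x = real n * ?D x"
    by (simp add: charlier_forward_shift Suc)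
  have e3: "?C x = x * ?D (x - 1) - a * ?D x"
    unfolding Suc by (rule charlier_backward_shift)
  show ?thesis
    unfolding e1 e2 e3
    by (simp add: algebra_simps)
qed (simp add: fwd_diff_def bwd_diff_def)

section \<open>Rational functions and their behaviour at infinity\<close>

text \<open>Agreement with p / q is required only off the roots of q, so the values that division by
  zero takes at poles do not matter.\<close>

definition rational_fun :: "(real \<Rightarrow> real) \<Rightarrow> bool" where
  "rational_fun f \<longleftrightarrow>
     (\<exists>p q. q \<noteq> 0 \<and> (\<forall>x. poly q x \<noteq> 0 \<longrightarrow> f x = poly p x / poly q x))"

lemma rational_funI:
  assumes "q \<noteq> 0" "\<And>x. poly q x \<noteq> 0 \<Longrightarrow> f x = poly p x / poly q x"
  shows "rational_fun f"
  using assms unfolding rational_fun_def by blast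

lemma rational_fun_const: "rational_fun (\<lambda>x. k)"
  by (rule rational_funI[of 1 _ "[:k:]"]) simp_all

lemma rational_fun_ident: "rational_fun (\<lambda>x. x)"
  by (rule rational_funI[of 1 _ "[:0, 1:]"]) simp_all

lemma rational_fun_add:
  assumes "rational_fun f" "rational_fun g"
  shows "rational_fun (\<lambda>x. f x + g x)"
proof -
  obtain p q p' q' where "q \<noteq> 0" "\<And>x. poly q x \<noteq> 0 \<Longrightarrow> f x = poly p x / poly q x"
    "q' \<noteq> 0" "\<And>x. poly q' x \<noteq> 0 \<Longrightarrow> g x = poly p' x / poly q' x"
    using assms unfolding rational_fun_def by blast
  then show ?thesis
    by (intro rational_funI[of "q * q'" _ "p * q' + p' * q"]) (simp_all add: add_frac_eq)
qed

lemma rational_fun_mult: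
  assumes "rational_fun f" "rational_fun g"
  shows "rational_fun (\<lambda>x. f x * g x)"
proof -
  obtain p q p' q' where "q \<noteq> 0" "\<And>x. poly q x \<noteq> 0 \<Longrightarrow> f x = poly p x / poly q x"
    "q' \<noteq> 0" "\<And>x. poly q' x \<noteq> 0 \<Longrightarrow> g x = poly p' x / poly q' x"
    using assms unfolding rational_fun_def by blast
  then show ?thesis
    by (intro rational_funI[of "q * q'" _ "p * p'"]) simp_all
qed

lemma rational_fun_inverse:
  assumes "rational_fun f"
  shows "rational_fun (\<lambda>x. inverse (f x))"
proof -
  obtain p q where q: "q \<noteq> 0" "\<And>x. poly q x \<noteq> 0 \<Longrightarrow> f x = poly p x / poly q x"
    using assms unfolding rational_fun_def by blast
  show ?thesis
  proof (cases "p = 0")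
    case True
    \<comment> \<open>Off the roots of q both f and its inverse are 0, by
      \<open>inverse 0 = 0\<close>.\<close>
    with q show ?thesis by (intro rational_funI[of q _ 0]) simp_all
  next
    case False
    \<comment> \<open>The fraction q / p is expanded by q so that a nonzero denominator also
      excludes the roots of q, where nothing is known about f.\<close>
    with q show ?thesis by (intro rational_funI[of "p * q" _ "q * q"]) simp_all
  qed
qed

lemma rational_fun_diff:
  assumes "rational_fun f" "rational_fun g"
  shows "rational_fun (\<lambda>x. f x - g x)"
  using rational_fun_add[OF assms(1) rational_fun_mult[OF rational_fun_const[of "-1"] assms(2)]]
  by simp

lemma rational_fun_minus: "rational_fun f \<Longrightarrow> rational_fun (\<lambda>x. - f x)"
  using rational_fun_diff[OF rational_fun_const[of 0]] by simp

lemma rational_fun_divide: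
  assumes "rational_fun f" "rational_fun g"
  shows "rational_fun (\<lambda>x. f x / g x)"
  using rational_fun_mult[OF assms(1) rational_fun_inverse[OF assms(2)]]
  by (simp add: divide_inverse)

lemmas rational_fun_intros = rational_fun_const rational_fun_ident rational_fun_add
  rational_fun_diff rational_fun_minus rational_fun_mult rational_fun_divide

text \<open>A nonzero limit excludes the zero numerator; the zeros of f then lie among the roots of
  p and q.\<close>

lemma finite_zeros_rational_fun:
  assumes "rational_fun f" "(f \<longlongrightarrow> l) at_top" "l \<noteq> 0"
  shows "finite {x. f x = 0}"
proof -
  obtain p q where q: "q \<noteq> 0" "\<And>x. poly q x \<noteq> 0 \<Longrightarrow> f x = poly p x / poly q x"
    using assms unfolding rational_fun_def by blast
  obtain N where N: "\<And>x. x \<ge> N \<Longrightarrow> f x \<noteq> 0"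
    using tendsto_imp_eventually_ne[OF assms(2,3)] by (auto simp: eventually_at_top_linorder)
  have "p \<noteq> 0"
  proof
    assume "p = 0"
    then have "{N..} \<subseteq> {x. poly q x = 0}"
      using N q(2) by fastforce
    with poly_roots_finite[OF q(1)] show False
      using infinite_Ici finite_subset by blast
  qed
  then have "finite ({x. poly p x = 0} \<union> {x. poly q x = 0})"
    using q(1) by (simp add: poly_roots_finite)
  moreover have "{x. f x = 0} \<subseteq> {x. poly p x = 0} \<union> {x. poly q x = 0}"
    using q(2) by auto
  ultimately show ?thesis
    by (metis finite_subset)
qed

section \<open>Limits at infinity\<close>

lemma tendsto_times_shift:
  fixes f :: "real \<Rightarrow> real"
  assumes "((\<lambda>x. x * f x) \<longlongrightarrow> l) at_top"
  shows "((\<lambda>x. x * f (x + s)) \<longlongrightarrow> l) at_top"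
proof -
  have s: "filterlim (\<lambda>x::real. x + s) at_top at_top"
    by real_asymp
  have "((\<lambda>x. x / (x + s) * ((x + s) * f (x + s))) \<longlongrightarrow> 1 * l) at_top"
  proof (rule tendsto_mult)
    show "((\<lambda>x::real. x / (x + s)) \<longlongrightarrow> 1) at_top"
      by real_asymp
    show "((\<lambda>x. (x + s) * f (x + s)) \<longlongrightarrow> l) at_top"
      using filterlim_compose[OF assms s] .
  qed
  moreover have "\<forall>\<^sub>F x in at_top. x / (x + s) * ((x + s) * f (x + s)) = x * f (x + s)"
    using eventually_gt_at_top[of "- s"] by eventually_elim simp
  ultimately show ?thesis
    by (simp add: tendsto_cong)
qed

lemma tendsto_zero_of_times:
  fixes f :: "real \<Rightarrow> real"
  assumes "((\<lambda>x. x * f x) \<longlongrightarrow> l) at_top"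
  shows "(f \<longlongrightarrow> 0) at_top"
proof -
  have "((\<lambda>x. inverse x * (x * f x)) \<longlongrightarrow> 0 * l) at_top"
    by (intro tendsto_mult tendsto_inverse_0_at_top filterlim_ident assms)
  moreover have "\<forall>\<^sub>F x in at_top. inverse x * (x * f x) = f x"
    using eventually_gt_at_top[of 0] by eventually_elim simp
  ultimately show ?thesis
    by (simp add: tendsto_cong)
qed

text \<open>The rational factors of \<open>A1\<close> and \<open>B1\<close> have this shape. The
  part with u decays like 1/x, so only v survives.\<close>

lemma tendsto_linear_fraction:
  fixes u v c :: real
  shows "((\<lambda>x. x * ((u + (x - c) * v) / ((x - c) * (x - c - 1)))) \<longlongrightarrow> v) at_top"
proof -
  have "((\<lambda>x. u * (x / ((x - c) * (x - c - 1))) + v * (x / (x - c - 1))) \<longlongrightarrow> u * 0 + v * 1) at_top"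
  proof (intro tendsto_add tendsto_mult tendsto_const)
    show "((\<lambda>x. x / ((x - c) * (x - c - 1))) \<longlongrightarrow> 0) at_top"
      by real_asymp
    show "((\<lambda>x. x / (x - c - 1)) \<longlongrightarrow> 1) at_top"
      by real_asymp
  qed
  moreover have "\<forall>\<^sub>F x in at_top. u * (x / ((x - c) * (x - c - 1))) + v * (x / (x - c - 1))
      = x * ((u + (x - c) * v) / ((x - c) * (x - c - 1)))"
    using eventually_gt_at_top[of c]
    by eventually_elim (simp add: add_divide_distrib distrib_left mult.commute)
  ultimately show ?thesis
    by (simp add: tendsto_cong)
qed

section \<open>Asymptotics of the coefficient functions and the exceptional set\<close>

context sobolev_charlier
begin

lemma rational_A1_B1:
  "rational_fun (\<lambda>x. A1 a c lam Q x n)" "rational_fun (\<lambda>x. B1 a c lam Q x n)"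
  "rational_fun (\<lambda>x. A1 a c lam Q (x + 1) n)" "rational_fun (\<lambda>x. B1 a c lam Q (x + 1) n)"
  "rational_fun (\<lambda>x. A1 a c lam Q (x - 1) n)" "rational_fun (\<lambda>x. B1 a c lam Q (x - 1) n)"
  unfolding A1_def B1_def by (intro rational_fun_intros)+

lemma rational_Lam: "rational_fun (\<lambda>x. Lam a c lam Q x n)"
  unfolding Lam_def A2_def B2_def by (intro rational_fun_intros rational_A1_B1)

lemma rational_Phi1: "rational_fun (\<lambda>x. Phi1 a c lam Q x n)"
  unfolding Phi1_def C3_def D3_def bwd_diff_def by (intro rational_fun_intros rational_A1_B1)

lemma rational_Xi1: "rational_fun (\<lambda>x. Xi1 a c lam Q x n)"
  unfolding Xi1_def C1_def D1_def by (intro rational_fun_intros rational_A1_B1 rational_Lam)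

text \<open>The limit of x B1 at infinity; the denominator is the squared norm of C_(n-1).\<close>

definition \<beta> :: "nat \<Rightarrow> real" where
  "\<beta> n = lam * (fwd_diff (poly (Q n)) c * fwd_diff (poly (charlier a n)) c)
     / (fact (n - 1) * a ^ (n - 1))"

lemma \<beta>_nonneg: "\<beta> n \<ge> 0"
  unfolding \<beta>_def using a_pos lam_nonneg fwd_diff_Q_charlier_nonneg[of n] by simp

lemma tendsto_times_B1:
  "((\<lambda>x. x * B1 a c lam Q x n) \<longlongrightarrow> \<beta> n) at_top"
proof -
  let ?k = "lam * (fwd_diff (poly (Q n)) c / (fact (n - 1) * a ^ (n - 1)))"
  have "((\<lambda>x. ?k * (x * ((poly (charlier a n) c + (x - c) * fwd_diff (poly (charlier a n)) c)
      / ((x - c) * (x - c - 1))))) \<longlongrightarrow> ?k * fwd_diff (poly (charlier a n)) c) at_top"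
    by (intro tendsto_mult tendsto_const tendsto_linear_fraction)
  then show ?thesis
    by (simp add: B1_def charlier_ip_self \<beta>_def mult_ac)
qed

lemma tendsto_A1: "((\<lambda>x. A1 a c lam Q x n) \<longlongrightarrow> 1) at_top"
proof -
  have "((\<lambda>x. A1 a c lam Q x n) \<longlongrightarrow> 1 - lam * (fwd_diff (poly (Q n)) c
                        / charlier_ip a (charlier a (n - 1)) (charlier a (n - 1))) * 0) at_top"
    unfolding A1_def
    by (intro tendsto_diff tendsto_mult tendsto_const tendsto_zero_of_times[OF tendsto_linear_fraction])
  then show ?thesis by simp
qed

lemma tendsto_B1: "((\<lambda>x. B1 a c lam Q (x + s) n) \<longlongrightarrow> 0) at_top"
  by (rule tendsto_zero_of_times[OF tendsto_times_shift[OF tendsto_times_B1]])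

lemma tendsto_A1_shift: "((\<lambda>x. A1 a c lam Q (x + s) n) \<longlongrightarrow> 1) at_top"
proof -
  have "filterlim (\<lambda>x::real. x + s) at_top at_top"
    by real_asymp
  then show ?thesis
    by (rule filterlim_compose[OF tendsto_A1])
qed

lemmas tendsto_A1_B1 = tendsto_A1 tendsto_A1_shift[of 1] tendsto_A1_shift[of "-1", simplified]
  tendsto_B1[of 0, simplified] tendsto_B1[of 1] tendsto_B1[of "-1", simplified]
  tendsto_times_B1 tendsto_times_shift[OF tendsto_times_B1, of 1]
  tendsto_times_shift[OF tendsto_times_B1, of "-1", simplified]

lemma tendsto_Lam:
  "((\<lambda>x. Lam a c lam Q x n) \<longlongrightarrow> 1 + \<beta> (n - 1) / (a * (real n - 1))) at_top"
proof -
  \<comment> \<open>For n = 1 this is \<open>inverse 0 = 0\<close>, in agreement with the quotient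
    in the limit.\<close>
  let ?k = "inverse (a * (real n - 1))"
  have "Lam a c lam Q x n = A1 a c lam Q x n * (A1 a c lam Q x (n - 1)
      + (x * B1 a c lam Q x (n - 1) - (real n + a - 1) * B1 a c lam Q x (n - 1)) * ?k)
      - B1 a c lam Q x n * (- B1 a c lam Q x (n - 1) * ?k)" for x
    by (simp add: Lam_def B2_def A2_def divide_inverse algebra_simps)
  moreover have "((\<lambda>x. A1 a c lam Q x n * (A1 a c lam Q x (n - 1)
      + (x * B1 a c lam Q x (n - 1) - (real n + a - 1) * B1 a c lam Q x (n - 1)) * ?k)
      - B1 a c lam Q x n * (- B1 a c lam Q x (n - 1) * ?k)) \<longlongrightarrow>
      1 * (1 + (\<beta> (n - 1) - (real n + a - 1) * 0) * ?k) - 0 * (- 0 * ?k)) at_top"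
    by (intro tendsto_intros tendsto_A1_B1)
  ultimately show ?thesis
    by (simp add: divide_inverse)
qed

text \<open>\<open>C3\<close> tends to 0 while x B1 stays bounded, so only the term with x D3
  contributes.\<close>

lemma tendsto_Phi1:
  "((\<lambda>x. x * Phi1 a c lam Q x n) \<longlongrightarrow> - (real n * a + \<beta> n)) at_top"
proof -
  have inv: "((\<lambda>x::real. inverse x) \<longlongrightarrow> 0) at_top"
    by (intro tendsto_inverse_0_at_top filterlim_ident)
  have C: "C3 a c lam Q x n = A1 a c lam Q x n - A1 a c lam Q (x - 1) n
      + real n * inverse x * A1 a c lam Q (x - 1) n - inverse x * B1 a c lam Q (x - 1) n" for x
    by (simp add: C3_def bwd_diff_def divide_inverse)
  have D: "x * D3 a c lam Q x n = x * B1 a c lam Q x n - x * B1 a c lam Q (x - 1) n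
        + real n * a * A1 a c lam Q (x - 1) n
        + (x * B1 a c lam Q (x - 1) n - a * B1 a c lam Q (x - 1) n)" if "x > 0" for x
    using that by (simp add: D3_def bwd_diff_def distrib_left right_diff_distrib left_diff_distrib
        diff_divide_distrib)
  have "((\<lambda>x. C3 a c lam Q x n * (x * B1 a c lam Q x n)
      - A1 a c lam Q x n * (x * B1 a c lam Q x n - x * B1 a c lam Q (x - 1) n
        + real n * a * A1 a c lam Q (x - 1) n
        + (x * B1 a c lam Q (x - 1) n - a * B1 a c lam Q (x - 1) n))) \<longlongrightarrow>
      (1 - 1 + real n * 0 * 1 - 0 * 0) * \<beta> n - 1 * (\<beta> n - \<beta> n + real n * a * 1 + (\<beta> n - a * 0))) at_top"
    unfolding C by (intro tendsto_intros tendsto_A1_B1 inv)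
  moreover have "\<forall>\<^sub>F x in at_top. C3 a c lam Q x n * (x * B1 a c lam Q x n)
      - A1 a c lam Q x n * (x * B1 a c lam Q x n - x * B1 a c lam Q (x - 1) n
        + real n * a * A1 a c lam Q (x - 1) n
        + (x * B1 a c lam Q (x - 1) n - a * B1 a c lam Q (x - 1) n)) = x * Phi1 a c lam Q x n"
    using eventually_gt_at_top[of 0]
  proof eventually_elim
    case (elim x)
    show ?case
      unfolding D[OF elim, symmetric] Phi1_def by (simp add: right_diff_distrib mult_ac)
  qed
  ultimately show ?thesis
    by (simp add: tendsto_cong)
qed

text \<open>\<open>C1\<close> tends to 0, so the numerator behaves like - D1, where x B1(x + 1) / a
  supplies \<beta> n / a. With n \<ge> 1 the limit of \<open>Lam\<close> is positive.\<close>

lemma tendsto_Xi1: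
  assumes "n \<ge> 1"
  shows "((\<lambda>x. Xi1 a c lam Q x n) \<longlongrightarrow>
    - (real n + \<beta> n / a) / (1 + \<beta> (n - 1) / (a * (real n - 1)))) at_top"
proof -
  have "1 + \<beta> (n - 1) / (a * (real n - 1)) > 0"
    using \<beta>_nonneg[of "n - 1"] a_pos assms by (intro add_pos_nonneg) auto
  then have nz: "1 + \<beta> (n - 1) / (a * (real n - 1)) \<noteq> 0"
    by simp
  have D: "D1 a c lam Q x n = real n * A1 a c lam Q (x + 1) n - B1 a c lam Q x n
        + (x * B1 a c lam Q (x + 1) n - (real n - 1) * B1 a c lam Q (x + 1) n) / a" for x
    by (simp add: D1_def left_diff_distrib distrib_right diff_divide_distrib add_divide_distrib)
  have "((\<lambda>x. Xi1 a c lam Q x n) \<longlongrightarrow>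
      ((1 - 1 - 1 / a * 0) * 0 - 1 * (real n * 1 - 0 + (\<beta> n - (real n - 1) * 0) / a))
      / (1 + \<beta> (n - 1) / (a * (real n - 1)))) at_top"
    unfolding Xi1_def C1_def D
    using a_pos nz by (intro tendsto_intros tendsto_A1_B1 tendsto_Lam) simp_all
  then show ?thesis
    by simp
qed

lemma finite_not_coeffs_defined:
  assumes "n \<ge> 1"
  shows "finite {x. \<not> coeffs_defined a c lam Q x n}"
proof -
  have pos: "1 + \<beta> (n - 1) / (a * (real n - 1)) > 0" "real n * a + \<beta> n > 0" "real n + \<beta> n / a > 0"
    using \<beta>_nonneg[of "n - 1"] \<beta>_nonneg[of n] a_pos assms by (auto intro!: add_pos_nonneg)
  have L: "finite {x. Lam a c lam Q x n = 0}"
    using pos by (intro finite_zeros_rational_fun[OF rational_Lam tendsto_Lam]) simp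
  have X: "finite {x. Xi1 a c lam Q x n = 0}"
    using pos assms by (intro finite_zeros_rational_fun[OF rational_Xi1 tendsto_Xi1]) auto
  \<comment> \<open>\<open>Phi1\<close> itself tends to 0, so the zeros are counted for x
    Phi1.\<close>
  have "finite {x. x * Phi1 a c lam Q x n = 0}"
    using pos
    by (intro finite_zeros_rational_fun[OF rational_fun_mult[OF rational_fun_ident rational_Phi1] tendsto_Phi1])
       simp
  then have P: "finite {x. Phi1 a c lam Q x n = 0}"
    by (rule rev_finite_subset) auto
  have shift: "finite {x. f (x + 1) = 0}" if "finite {x. f x = 0}" for f :: "real \<Rightarrow> real"
    using finite_vimageI[OF that, of "\<lambda>x. x + 1"] by (simp add: vimage_def)
  \<comment> \<open>The points c - 2, ..., c + 2 are those for which one of x - 1, ..., x + 2 is c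
    or c + 1.\<close>
  have "{x. \<not> coeffs_defined a c lam Q x n} \<subseteq> {c + 1, c, c - 1, c - 2, c + 2, 0, - 1}
      \<union> {x. Lam a c lam Q x n = 0} \<union> {x. Lam a c lam Q (x + 1) n = 0}
      \<union> {x. Phi1 a c lam Q x n = 0} \<union> {x. Phi1 a c lam Q (x + 1) n = 0}
      \<union> {x. Xi1 a c lam Q x n = 0}"
    unfolding coeffs_defined_def by (auto simp: algebra_simps)
  moreover have "finite \<dots>"
    using L P X shift[OF L] shift[OF P] by simp
  ultimately show ?thesis
    by (rule finite_subset)
qed

end

text \<open>The equation is an identity of rational functions, asserted wherever no denominator
  vanishes; finiteness of the exceptional set keeps this from being vacuous.\<close>

theorem theorem4:
  fixes a c lam :: real and n :: nat and Q :: "nat \<Rightarrow> real poly"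
  assumes "a > 0" and "lam \<ge> 0" and "n \<ge> 1"
    and "\<forall>k::nat. real k \<notin> {c<..<c + 1}"
    and "monic_orthogonal_seq (sobolev_ip a c lam) Q"
  shows "finite {x. \<not> coeffs_defined a c lam Q x n} \<and>
    (\<forall>x. coeffs_defined a c lam Q x n \<longrightarrow>
       sigma_coeff a c lam Q x n * fwd_diff (bwd_diff (poly (Q n))) x
       + tau_coeff a c lam Q x n * fwd_diff (poly (Q n)) x
       + mu_coeff a c lam Q x n * poly (Q n) x = 0) \<and>
    (lam = 0 \<longrightarrow>
       Q n = charlier a n \<and>
       (\<forall>x. x \<noteq> 0 \<and> x \<noteq> - 1 \<longrightarrow>
          sigma_coeff a c lam Q x n = x / a \<and>
          tau_coeff a c lam Q x n = (a - x) / a \<and>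
          mu_coeff a c lam Q x n = real n / a) \<and>
       (\<forall>x. x * fwd_diff (bwd_diff (poly (charlier a n))) x
          + (a - x) * fwd_diff (poly (charlier a n)) x
          + real n * poly (charlier a n) x = 0))"
proof -
  interpret sobolev_charlier a c lam Q
    using assms by unfold_locales
  have "Q n = charlier a n" if "lam = 0"
    using Q_expansion[of n] that by (simp add: poly_eq_poly_eq_iff[symmetric] fun_eq_iff)
  then show ?thesis
    using finite_not_coeffs_defined difference_equation coeffs_lam_0
      charlier_difference_equation assms(1,3) by simp
qed

end
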